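(* For $(x,T)\in X\times\mathbb{N}^0$ let $\langle x_t\mid t\ge T\rangle\in\mathcal{S}^T(x)$. Then for all $t>T$ the following conditions must be satisfied. (i) If $a_t>0$, then: $x_t=\min\{c_{t-1}+a_{t-1}x_{t-1},\,b\}$ if $p^{(t)}>0$, and $x_t=\max\left\{0,\frac{x_{t+1}-c_t}{a_t}\right\}$ if $p^{(t)}<0$. (ii) If $a_t=0$, then: $x_t=\min\{c_{t-1}+a_{t-1}x_{t-1},\,b\}$ if $p^{(t)}>0$, and $x_t=0$ if $p^{(t)}<0$. (iii) If $a_t<0$, then: $x_t=\min\left\{\frac{x_{t+1}-c_t}{a_t},\ \min\{c_{t-1}+a_{t-1}x_{t-1},\,b\}\right\}$ if $p^{(t)}>0$, and $x_t=0$ if $p^{(t)}<0$.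
   Context: $\mathbb{N}$ is the set of strictly positive integers and $\mathbb{N}^0=\mathbb{N}\cup\{0\}$. Fix a real number $b>0$ and let $X=[0,b]\subset\mathbb{R}$. A linear dynamic optimization problem with linear constraints (LDO-LC problem) $\langle(p^{(t)},c_t,a_t)\mid t\in\mathbb{N}^0\rangle$ is given by real sequences with $c_t\ge 0$ and $c_t+a_tb\ge 0$ for all $t\in\mathbb{N}^0$, $\sum_{t=0}^\infty|c_t|<+\infty$, $\sum_{t=0}^\infty|a_t|<+\infty$ and $\sum_{t=0}^\infty|p^{(t)}|<+\infty$. (These imply $c_t+a_tx\ge 0$ for all $x\in X$.) Throughout such a problem is given. For $t\in\mathbb{N}^0$ and $x\in X$, let $\Omega_t(x)=\{y\in[0,b]\mid y\le c_t+a_tx\}=[0,\min\{c_t+a_tx,b\}]$. For $x\in X$ and $T\in\mathbb{N}^0$, $\mathcal{F}^T(x)$ is the set of trajectories starting at $x$ at time-period $T$, i.e. of all sequences $\langle x_t\mid t\ge T\rangle$ in $X$ with $x_T=x$ and $x_{t+1}\in\Omega_t(x_t)$ for all $t\ge T$; and $\mathcal{S}^T(x)=\operatorname{argmax}_{\langle x_t\mid t\ge T\rangle\in\mathcal{F}^T(x)}\sum_{t=T}^\infty p^{(t)}x_t$ is the set of optimal trajectories beginning at $x$ at time-period $T$. *)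

theory Defs
  imports Complex_Main "HOL-Library.FuncSet"
begin

definition LDO_LC_problem ::
    "real \<Rightarrow> (nat \<Rightarrow> real) \<Rightarrow> (nat \<Rightarrow> real) \<Rightarrow> (nat \<Rightarrow> real) \<Rightarrow> bool" where
  "LDO_LC_problem b p c a \<longleftrightarrow>
     b > 0 \<and> (\<forall>t. c t \<ge> 0 \<and> c t + a t * b \<ge> 0) \<and>
     summable (\<lambda>t. \<bar>c t\<bar>) \<and> summable (\<lambda>t. \<bar>a t\<bar>) \<and> summable (\<lambda>t. \<bar>p t\<bar>)"

definition constraint_set ::
    "real \<Rightarrow> (nat \<Rightarrow> real) \<Rightarrow> (nat \<Rightarrow> real) \<Rightarrow> nat \<Rightarrow> real \<Rightarrow> real set" where
  "constraint_set b c a t x = {y \<in> {0..b}. y \<le> c t + a t * x}"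

text \<open>A sequence indexed by \<open>t \<ge> T\<close> is represented by a function on all of \<open>nat\<close>
  whose values below \<open>T\<close> are unconstrained and never used.\<close>

definition trajectories ::
    "real \<Rightarrow> (nat \<Rightarrow> real) \<Rightarrow> (nat \<Rightarrow> real) \<Rightarrow> nat \<Rightarrow> real \<Rightarrow> (nat \<Rightarrow> real) set" where
  "trajectories b c a T x0 =
     {x \<in> {T..} \<rightarrow> {0..b}. x T = x0 \<and> (\<forall>t\<ge>T. x (Suc t) \<in> constraint_set b c a t (x t))}"

definition payoff :: "(nat \<Rightarrow> real) \<Rightarrow> nat \<Rightarrow> (nat \<Rightarrow> real) \<Rightarrow> real" where
  "payoff p T x = (\<Sum>n. p (n + T) * x (n + T))"

definition optimal_trajectories ::
    "real \<Rightarrow> (nat \<Rightarrow> real) \<Rightarrow> (nat \<Rightarrow> real) \<Rightarrow> (nat \<Rightarrow> real) \<Rightarrow> nat \<Rightarrow> real \<Rightarrow> (nat \<Rightarrow> real) set" where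
  "optimal_trajectories b p c a T x0 =
     {x. is_arg_max (payoff p T) (\<lambda>x. x \<in> trajectories b c a T x0) x}"

end

theory Submission
  imports Defs
begin

text \<open>Changing an optimal trajectory at the single period \<open>t\<close> to a value that is still compatible
  with its two neighbours changes the payoff by \<open>p t\<close> times the change of \<open>x t\<close>. Hence \<open>x t\<close> is
  the largest compatible value if \<open>p t > 0\<close> and the smallest if \<open>p t < 0\<close>. In each case of the
  theorem, the claimed value is this extreme point.\<close>

text \<open>Trajectories stay in \<open>{0..b}\<close>, so the terms are dominated by
  \<open>\<bar>p (n + T)\<bar> * b\<close>, and \<open>p\<close> is absolutely summable.\<close>

lemma summable_payoff:
  assumes "LDO_LC_problem b p c a" and "x \<in> trajectories b c a T x0"
  shows "summable (\<lambda>n. p (n + T) * x (n + T))"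
proof (rule summable_comparison_test')
  have "summable (\<lambda>n. \<bar>p (n + T)\<bar>)"
    using assms(1) unfolding LDO_LC_problem_def by (simp add: summable_iff_shift[of "\<lambda>n. \<bar>p n\<bar>"])
  then show "summable (\<lambda>n. \<bar>p (n + T)\<bar> * b)"
    by (rule summable_mult2)
  show "norm (p (n + T) * x (n + T)) \<le> \<bar>p (n + T)\<bar> * b" if "n \<ge> 0" for n
  proof -
    have "x (n + T) \<in> {0..b}"
      using assms(2) unfolding trajectories_def by (auto simp: Pi_iff)
    then show ?thesis
      by (auto simp: abs_mult intro!: mult_left_mono)
  qed
qed

lemma payoff_upd:
  assumes "summable (\<lambda>n. p (n + T) * x (n + T))" and "t \<ge> T"
  shows "payoff p T (x(t := y)) = payoff p T x + p t * (y - x t)"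
proof -
  \<comment> \<open>The update perturbs one term of the series, so a one-term series is added. As
    \<open>t \<ge> T\<close>, the truncated subtraction is exact and index \<open>t - T\<close> is
    period \<open>t\<close>.\<close>
  have "(\<lambda>n. if n = t - T then p t * (y - x t) else 0) sums (p t * (y - x t))"
    by (rule sums_single)
  from sums_add[OF summable_sums[OF assms(1)] this]
  have "(\<lambda>n. p (n + T) * x (n + T) + (if n = t - T then p t * (y - x t) else 0))
      sums (payoff p T x + p t * (y - x t))"
    unfolding payoff_def .
  moreover have "(\<lambda>n. p (n + T) * x (n + T) + (if n = t - T then p t * (y - x t) else 0))
      = (\<lambda>n. p (n + T) * (x(t := y)) (n + T))"
    using assms(2) by (auto simp: fun_eq_iff algebra_simps)
  ultimately show ?thesis
    unfolding payoff_def by (simp add: sums_iff)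
qed

text \<open>Only two transitions involve \<open>x t\<close>: the one into period \<open>t\<close>
  and the one out of it. The last two premises secure them, and the strict \<open>t > T\<close>
  protects the initial value.\<close>

lemma trajectory_upd:
  assumes "x \<in> trajectories b c a T x0" and "t > T"
    and "y \<in> constraint_set b c a (t - 1) (x (t - 1))"
    and "x (Suc t) \<le> c t + a t * y"
  shows "x(t := y) \<in> trajectories b c a T x0"
proof -
  have x: "x \<in> {T..} \<rightarrow> {0..b}" "x T = x0"
    and step: "\<And>s. s \<ge> T \<Longrightarrow> x (Suc s) \<in> constraint_set b c a s (x s)"
    using assms(1) by (auto simp: trajectories_def)
  have "(x(t := y)) (Suc s) \<in> constraint_set b c a s ((x(t := y)) s)" if "s \<ge> T" for s
    using step[OF that] assms(3,4) by (auto simp: constraint_set_def)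
  then show ?thesis
    using x assms(2,3) by (auto simp: trajectories_def constraint_set_def Pi_iff)
qed

lemma optimal_trajectory_one_period:
  assumes "LDO_LC_problem b p c a" and "x \<in> optimal_trajectories b p c a T x0" and "t > T"
    and "y \<in> constraint_set b c a (t - 1) (x (t - 1))"
    and "x (Suc t) \<le> c t + a t * y"
  shows "p t * y \<le> p t * x t"
proof -
  have x: "x \<in> trajectories b c a T x0"
    and max: "\<And>z. z \<in> trajectories b c a T x0 \<Longrightarrow> \<not> payoff p T z > payoff p T x"
    using assms(2) by (auto simp: optimal_trajectories_def is_arg_max_def)
  have "\<not> payoff p T (x(t := y)) > payoff p T x"
    using max trajectory_upd[OF x assms(3-5)] by blast
  then show ?thesis
    using payoff_upd[OF summable_payoff[OF assms(1) x], of t y] assms(3)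
    by (simp add: right_diff_distrib)
qed

theorem proposition7:
  fixes b x0 :: real and p c a x :: "nat \<Rightarrow> real" and T :: nat
  assumes "LDO_LC_problem b p c a"
    and "x0 \<in> {0..b}"
    and "x \<in> optimal_trajectories b p c a T x0"
  shows "\<forall>t>T.
    (a t > 0 \<longrightarrow>
       (p t > 0 \<longrightarrow> x t = min (c (t - 1) + a (t - 1) * x (t - 1)) b) \<and>
       (p t < 0 \<longrightarrow> x t = max 0 ((x (t + 1) - c t) / a t))) \<and>
    (a t = 0 \<longrightarrow>
       (p t > 0 \<longrightarrow> x t = min (c (t - 1) + a (t - 1) * x (t - 1)) b) \<and>
       (p t < 0 \<longrightarrow> x t = 0)) \<and>
    (a t < 0 \<longrightarrow>
       (p t > 0 \<longrightarrow> x t = min ((x (t + 1) - c t) / a t)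
                            (min (c (t - 1) + a (t - 1) * x (t - 1)) b)) \<and>
       (p t < 0 \<longrightarrow> x t = 0))"
proof (intro allI impI)
  fix t assume t: "t > T"
  \<comment> \<open>Given \<open>x (t - 1)\<close>, the admissible values at \<open>t\<close> form
    the interval from \<open>0\<close> to \<open>u\<close>. For \<open>a t \<noteq> 0\<close>, the
    constraint on \<open>x (t + 1)\<close> is tight exactly at the value \<open>r\<close>.\<close>
  define u where "u = min (c (t - 1) + a (t - 1) * x (t - 1)) b"
  define r where "r = (x (t + 1) - c t) / a t"
  have step: "x (Suc s) \<in> constraint_set b c a s (x s)" if "s \<ge> T" for s
    using assms(3) that
    by (auto simp: optimal_trajectories_def is_arg_max_def trajectories_def)
  have xt: "0 \<le> x t" "x t \<le> u"
    using step[of "t - 1"] t by (auto simp: constraint_set_def u_def)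
  have next_le: "x (Suc t) \<le> c t + a t * x t"
    using step[of t] t by (auto simp: constraint_set_def)
  have one_period: "p t * y \<le> p t * x t" if "0 \<le> y" "y \<le> u" "x (Suc t) \<le> c t + a t * y" for y
    using optimal_trajectory_one_period[OF assms(1,3) t, of y] that
    by (simp add: constraint_set_def u_def)
  \<comment> \<open>Cancelling \<open>p t > 0\<close> in \<open>one_period\<close> yields
    \<open>y \<le> x t\<close>; in \<open>lower\<close>, the negative sign reverses this. The
    remaining bound on \<open>y\<close> follows from \<open>xt\<close>.\<close>
  have upper: "x t = y" if "p t > 0" "x t \<le> y" "y \<le> u" "x (Suc t) \<le> c t + a t * y" for y
    using one_period[of y] that xt by simp
  have lower: "x t = y" if "p t < 0" "y \<le> x t" "0 \<le> y" "x (Suc t) \<le> c t + a t * y" for y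
    using one_period[of y] that xt by simp
  consider (pos) "a t > 0" | (zero) "a t = 0" | (neg) "a t < 0"
    by linarith
  then have "(a t > 0 \<longrightarrow> (p t > 0 \<longrightarrow> x t = u) \<and> (p t < 0 \<longrightarrow> x t = max 0 r)) \<and>
      (a t = 0 \<longrightarrow> (p t > 0 \<longrightarrow> x t = u) \<and> (p t < 0 \<longrightarrow> x t = 0)) \<and>
      (a t < 0 \<longrightarrow> (p t > 0 \<longrightarrow> x t = min r u) \<and> (p t < 0 \<longrightarrow> x t = 0))"
  proof cases
    case pos
    \<comment> \<open>Here \<open>r\<close> is a lower bound: the compatible values run from
      \<open>max 0 r\<close> to \<open>u\<close>, and \<open>u\<close> qualifies because
      \<open>r \<le> x t \<le> u\<close>.\<close>
    have feasible_iff: "x (Suc t) \<le> c t + a t * y \<longleftrightarrow> r \<le> y" for y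
      using pos by (simp add: r_def field_simps)
    have "r \<le> x t"
      using next_le feasible_iff by blast
    then show ?thesis
      using pos xt upper[of u] lower[of "max 0 r"] by (auto simp: feasible_iff)
  next
    case zero
    \<comment> \<open>The constraint on \<open>x (t + 1)\<close> does not depend on the value at
      \<open>t\<close>, so both \<open>0\<close> and \<open>u\<close> are compatible.\<close>
    then show ?thesis
      using xt next_le upper[of u] lower[of 0] by auto
  next
    case neg
    \<comment> \<open>Dividing by the negative \<open>a t\<close> turns \<open>r\<close> into an
      upper bound: the compatible values run from \<open>0\<close> to \<open>min r u\<close>, and
      \<open>0\<close> qualifies because \<open>0 \<le> x t \<le> r\<close>.\<close>
    have feasible_iff: "x (Suc t) \<le> c t + a t * y \<longleftrightarrow> y \<le> r" for y
      using neg by (simp add: r_def field_simps)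
    have "x t \<le> r"
      using next_le feasible_iff by blast
    then show ?thesis
      using neg xt upper[of "min r u"] lower[of 0] feasible_iff[of 0]
      by (auto simp: feasible_iff)
  qed
  then show "(a t > 0 \<longrightarrow>
       (p t > 0 \<longrightarrow> x t = min (c (t - 1) + a (t - 1) * x (t - 1)) b) \<and>
       (p t < 0 \<longrightarrow> x t = max 0 ((x (t + 1) - c t) / a t))) \<and>
    (a t = 0 \<longrightarrow>
       (p t > 0 \<longrightarrow> x t = min (c (t - 1) + a (t - 1) * x (t - 1)) b) \<and>
       (p t < 0 \<longrightarrow> x t = 0)) \<and>
    (a t < 0 \<longrightarrow>
       (p t > 0 \<longrightarrow> x t = min ((x (t + 1) - c t) / a t)
                            (min (c (t - 1) + a (t - 1) * x (t - 1)) b)) \<and>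
       (p t < 0 \<longrightarrow> x t = 0))"
    unfolding u_def r_def .
qed

end
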